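(* Let $G=(V,E)$ be a finite simple undirected graph with edge-weights $w:E\to\mathbb{Z}$, and let $\ell\in\mathbb{N}$, $\ell\ge 1$. Assume that $G$ contains an $\ell$-th smallest perfect matching $M$. Then there exists a subset of edges $F\subseteq E$ with $|F|\le 2(\ell-1)$ such that \[ w(M)=\min_{M'\in\mathcal{M}_G\,:\,F\subseteq M'} w(M'). \]
   Context: For $X\subseteq E$, $w(X)=\sum_{e\in X}w(e)$. $\mathcal{M}_G$ denotes the set of all perfect matchings of $G$ (a perfect matching is a set of edges covering every vertex exactly once). The $\ell$-th smallest perfect matchings are defined recursively: the $1$st-smallest perfect matchings are exactly the minimum-weight perfect matchings of $G$; for $\ell\ge 2$, a perfect matching is $\ell$-th smallest if and only if it has minimum weight among all perfect matchings that are not $\ell'$-th smallest for any $\ell'<\ell$. *)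

theory Defs
  imports Main
begin

definition simple_graph :: "'v set \<Rightarrow> 'v set set \<Rightarrow> bool" where
  "simple_graph V E \<longleftrightarrow> finite V \<and> (\<forall>e\<in>E. e \<subseteq> V \<and> card e = 2)"

definition perfect_matchings :: "'v set \<Rightarrow> 'v set set \<Rightarrow> 'v set set set" where
  "perfect_matchings V E = {M. M \<subseteq> E \<and> (\<forall>v\<in>V. \<exists>!e. e \<in> M \<and> v \<in> e)}"

definition weight :: "('e \<Rightarrow> int) \<Rightarrow> 'e set \<Rightarrow> int" where
  "weight w X = (\<Sum>e\<in>X. w e)"

definition min_weight_members :: "('e \<Rightarrow> int) \<Rightarrow> 'e set set \<Rightarrow> 'e set set" where
  "min_weight_members w A = {M \<in> A. \<forall>M'\<in>A. weight w M \<le> weight w M'}"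

(* The index starts at 1; the value at 0 is a dummy. *)
fun smallest_perfect_matchings ::
  "'v set \<Rightarrow> 'v set set \<Rightarrow> ('v set \<Rightarrow> int) \<Rightarrow> nat \<Rightarrow> 'v set set set" where
  "smallest_perfect_matchings V E w 0 = {}"
| "smallest_perfect_matchings V E w (Suc 0) = min_weight_members w (perfect_matchings V E)"
| "smallest_perfect_matchings V E w (Suc (Suc k)) =
     min_weight_members w
       (perfect_matchings V E - (\<Union>l'\<in>{1..<Suc (Suc k)}. smallest_perfect_matchings V E w l'))"

end

theory Submission
  imports Defs
begin

text \<open>
  Complementary slackness for Edmonds' odd-set inequalities: if \<open>M\<close> is a perfect matching that is not of
  minimum weight, then either one of its edges is not tight for an optimal dual solution, or \<open>M\<close> has at
  least two edges leaving some odd set \<open>U\<close> of positive dual value. That edge, respectively two of those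
  edges, lie together in no minimum-weight perfect matching. Forcing them removes the smallest
  weight, so that \<open>l - 1\<close> such steps suffice. The dual solution is built by the Cunningham--Marsh
  induction on the total weight, in the form given by Schrijver.
\<close>

text \<open>Duality is established for maximum-weight matchings that may leave vertices uncovered.
  There an edge of nonpositive weight can be deleted without harm, whereas in the perfect problem a
  deletion may destroy every feasible solution. Complementing the weights with a large offset leads
  back to perfect matchings.

  The factor 2 comes from the odd sets: if \<open>U\<close> has positive dual value, every
  minimum-weight perfect matching has exactly one edge leaving \<open>U\<close>. A single such edge
  of \<open>M\<close> may therefore occur in an optimum, but two of them cannot occur together.

  All forced edges belong to \<open>M\<close>, so \<open>M\<close> survives every step. Iteration
  has to compare only matchings that contain the edges forced so far; the graph stays fixed and the
  weights are modified instead. The decreasing quantity is the number of distinct weights below that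
  of \<open>M\<close>, since matchings of equal weight disappear together.\<close>

section \<open>Matchings, components and exchange\<close>

definition matching :: "'v set set \<Rightarrow> 'v set set \<Rightarrow> bool" where
  "matching E M \<longleftrightarrow> M \<subseteq> E \<and> pairwise disjnt M"

definition edges_in :: "'v set set \<Rightarrow> 'v set \<Rightarrow> 'v set set" where
  "edges_in M C = {e \<in> M. e \<subseteq> C}"

definition adjacency :: "'v set set \<Rightarrow> ('v \<times> 'v) set" where
  "adjacency E = {(x, y). {x, y} \<in> E}"

lemma finite_has_argmax:
  fixes f :: "'a \<Rightarrow> 'b::linorder"
  assumes "finite A" "A \<noteq> {}"
  obtains x where "x \<in> A" "\<And>y. y \<in> A \<Longrightarrow> f y \<le> f x"
proof -
  have "Max (f ` A) \<in> f ` A" using assms by (intro Max_in) auto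
  then obtain x where "x \<in> A" "f x = Max (f ` A)" by auto
  with that assms show ?thesis by (metis Max_ge finite_imageI imageI)
qed

lemma simple_graph_finite_edges: "simple_graph V E \<Longrightarrow> finite E"
  unfolding simple_graph_def by (metis PowI finite_Pow_iff finite_subset subsetI)

lemma simple_graph_subset: "simple_graph V E \<Longrightarrow> D \<subseteq> E \<Longrightarrow> simple_graph V D"
  unfolding simple_graph_def by blast

lemma edge_props:
  assumes "simple_graph V E" "e \<in> E"
  shows "e \<subseteq> V" "card e = 2" "finite e" "e \<noteq> {}"
  using assms unfolding simple_graph_def by (auto intro: finite_subset)

lemma card_edges_in_subset:
  assumes "simple_graph V E" "matching E M"
  shows "2 * card (edges_in M C) = card (\<Union>(edges_in M C))"
proof -
  have "card (\<Union>(edges_in M C)) = sum card (edges_in M C)"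
    using assms edge_props(3)[OF assms(1)] unfolding matching_def edges_in_def
    by (intro card_Union_disjoint) (auto simp: pairwise_def)
  also have "\<dots> = sum (\<lambda>_. 2) (edges_in M C)"
    using assms edge_props(2)[OF assms(1)] unfolding matching_def edges_in_def
    by (intro sum.cong) auto
  finally show ?thesis by simp
qed

text \<open>The spanning-tree bound without building a tree: a largest set that contains
  \<open>t\<close> and satisfies the bound is closed under adjacency.\<close>

lemma card_le_edges_of_connected:
  assumes sg: "simple_graph V D" and t: "t \<in> V"
  defines "C \<equiv> {x. (t, x) \<in> (adjacency D)\<^sup>*}"
  shows "card C \<le> card (edges_in D C) + 1" "C \<subseteq> V"
proof -
  have CV: "C \<subseteq> V"
  proof
    fix x assume "x \<in> C"
    then have "(t, x) \<in> (adjacency D)\<^sup>*" by (simp add: C_def)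
    then show "x \<in> V" using t edge_props(1)[OF sg]
      by (induction) (auto simp: adjacency_def)
  qed
  then show "C \<subseteq> V" .
  have finC: "finite C" using CV sg finite_subset unfolding simple_graph_def by blast
  have finD: "finite D" using sg simple_graph_finite_edges by blast
  have tC: "t \<in> C" by (simp add: C_def)
  define \<S> where "\<S> = {S. S \<subseteq> C \<and> t \<in> S \<and> card S \<le> card (edges_in D S) + 1}"
  have "{t} \<in> \<S>" using tC by (simp add: \<S>_def)
  moreover have "finite \<S>" using finC by (simp add: \<S>_def)
  ultimately obtain S where S: "S \<in> \<S>" and Smax: "\<And>S'. S' \<in> \<S> \<Longrightarrow> card S' \<le> card S"
    using finite_has_argmax[of \<S> card] by blast
  have "x \<in> S" if "(t, x) \<in> (adjacency D)\<^sup>*" for x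
    using that
  proof (induction)
    case base then show ?case using S by (simp add: \<S>_def)
  next
    case (step x y)
    show ?case
    proof (rule ccontr)
      assume "y \<notin> S"
      have e: "{x, y} \<in> D" using step(2) by (simp add: adjacency_def)
      have finS: "finite S" using S finC finite_subset by (auto simp: \<S>_def)
      \<comment> \<open>Adding \<open>y\<close> costs one vertex and gains at least the edge
        \<open>{x, y}\<close>, so the bound survives.\<close>
      have "insert {x, y} (edges_in D S) \<subseteq> edges_in D (insert y S)"
        using e step(3) by (auto simp: edges_in_def)
      moreover have "{x, y} \<notin> edges_in D S" using \<open>y \<notin> S\<close> by (auto simp: edges_in_def)
      moreover have "finite (edges_in D (insert y S))" "finite (edges_in D S)"
        using finD by (auto simp: edges_in_def)
      ultimately have "card (edges_in D S) + 1 \<le> card (edges_in D (insert y S))"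
        by (metis Suc_eq_plus1 card_insert_disjoint card_mono)
      moreover have "y \<in> C" using step(1,2) by (auto simp: C_def)
      ultimately have "insert y S \<in> \<S>" using S finS \<open>y \<notin> S\<close> by (auto simp: \<S>_def)
      from Smax[OF this] show False using finS \<open>y \<notin> S\<close> by simp
    qed
  qed
  then have "S = C" using S by (auto simp: \<S>_def C_def)
  then show "card C \<le> card (edges_in D C) + 1" using S by (simp add: \<S>_def)
qed

lemma component_closed:
  fixes t :: 'v
  assumes "simple_graph V D" "e \<in> D"
  defines "C \<equiv> {x. (t, x) \<in> (adjacency D)\<^sup>*}"
  shows "e \<subseteq> C \<or> e \<inter> C = {}"
proof -
  obtain a b where "e = {a, b}" using edge_props(2)[OF assms(1,2)] by (meson card_2_iff)
  then have "(a, b) \<in> adjacency D" "(b, a) \<in> adjacency D"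
    using assms(2) by (auto simp: adjacency_def insert_commute)
  then show ?thesis unfolding C_def \<open>e = {a, b}\<close>
    by (auto intro: rtrancl_into_rtrancl)
qed

text \<open>Counting replaces the analysis of alternating paths. Let \<open>C\<close> be the
  component of \<open>t\<close> in \<open>M \<union> N\<close>, with m edges of \<open>M\<close> and
  n edges of \<open>N\<close> inside. Connectivity gives \<open>card C \<le> m + n + 1\<close>, and
  \<open>2 * n + 1 \<le> card C\<close> because \<open>N\<close> misses \<open>t\<close>; hence
  \<open>n \<le> m\<close>. If \<open>M\<close> missed two vertices of \<open>C\<close>, then also
  \<open>2 * m + 2 \<le> card C\<close>, and the three bounds are incompatible.\<close>

lemma exchange_component:
  assumes sg: "simple_graph V E" and M: "matching E M" and N: "matching E N"
    and t: "t \<in> V" "t \<notin> \<Union>N" and uv: "u \<noteq> v" "u \<notin> \<Union>M" "v \<notin> \<Union>M"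
  obtains C where "t \<in> C" "\<And>e. e \<in> M \<union> N \<Longrightarrow> e \<subseteq> C \<or> e \<inter> C = {}"
    "card (edges_in N C) \<le> card (edges_in M C)" "u \<notin> C \<or> v \<notin> C"
    "C \<subseteq> {x. (t, x) \<in> (adjacency E)\<^sup>*}"
proof -
  define C where "C = {x. (t, x) \<in> (adjacency (M \<union> N))\<^sup>*}"
  have sub: "M \<union> N \<subseteq> E" using M N by (auto simp: matching_def)
  have sg': "simple_graph V (M \<union> N)" using simple_graph_subset[OF sg sub] .
  note conn = card_le_edges_of_connected[OF sg' t(1), folded C_def]
  have finC: "finite C" using conn(2) sg finite_subset unfolding simple_graph_def by blast
  have tC: "t \<in> C" by (simp add: C_def)
  have "edges_in (M \<union> N) C = edges_in M C \<union> edges_in N C" by (auto simp: edges_in_def)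
  then have edges: "card C \<le> card (edges_in M C) + card (edges_in N C) + 1"
    using conn(1) card_Un_le[of "edges_in M C" "edges_in N C"] by simp
  have "\<Union>(edges_in N C) \<subseteq> C - {t}" using t by (auto simp: edges_in_def)
  then have "card (\<Union>(edges_in N C)) \<le> card (C - {t})" using finC by (intro card_mono) auto
  then have n: "2 * card (edges_in N C) + 1 \<le> card C"
    using card_edges_in_subset[OF sg N, of C] tC finC card_gt_0_iff[of C]
    by (auto simp: card_Diff_singleton)
  have "u \<notin> C \<or> v \<notin> C"
  proof (rule ccontr)
    assume "\<not> (u \<notin> C \<or> v \<notin> C)"
    then have uvC: "{u, v} \<subseteq> C" by auto
    have "\<Union>(edges_in M C) \<subseteq> C - {u, v}" using uv by (auto simp: edges_in_def)
    then have "card (\<Union>(edges_in M C)) \<le> card (C - {u, v})" using finC by (intro card_mono) auto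
    also have "\<dots> = card C - 2" using uvC uv(1) by (subst card_Diff_subset) auto
    finally have "2 * card (edges_in M C) \<le> card C - 2"
      using card_edges_in_subset[OF sg M, of C] by simp
    moreover have "card C \<ge> 2" using card_mono[OF finC uvC] uv(1) by simp
    ultimately show False using n edges by linarith
  qed
  moreover have "card (edges_in N C) \<le> card (edges_in M C)" using n edges by linarith
  moreover have "C \<subseteq> {x. (t, x) \<in> (adjacency E)\<^sup>*}"
    using rtrancl_mono[of "adjacency (M \<union> N)" "adjacency E"] sub
    by (auto simp: C_def adjacency_def)
  ultimately show ?thesis using that tC component_closed[OF sg', of _ t, folded C_def] by blast
qed

lemma matching_swap:
  assumes M: "matching E M" and N: "matching E N"
    and cl: "\<And>e. e \<in> M \<union> N \<Longrightarrow> e \<subseteq> C \<or> e \<inter> C = {}"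
  shows "matching E ((M - edges_in M C) \<union> edges_in N C)"
proof -
  have "disjnt e f" if "e \<in> (M - edges_in M C)" "f \<in> edges_in N C" for e f
    using that cl[of e] by (auto simp: edges_in_def disjnt_def)
  then have "pairwise disjnt ((M - edges_in M C) \<union> edges_in N C)"
    using M N unfolding matching_def pairwise_def edges_in_def
    by (metis (lifting) DiffD1 Un_iff disjnt_sym mem_Collect_eq)
  then show ?thesis using M N by (auto simp: matching_def edges_in_def)
qed

lemma sum_swap:
  fixes f :: "'v set \<Rightarrow> 'a::ab_group_add"
  assumes "simple_graph V E" "M \<subseteq> E" "N \<subseteq> E"
    and cl: "\<And>e. e \<in> M \<union> N \<Longrightarrow> e \<subseteq> C \<or> e \<inter> C = {}"
  shows "sum f ((M - edges_in M C) \<union> edges_in N C)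
    = sum f M - sum f (edges_in M C) + sum f (edges_in N C)"
proof -
  have fin: "finite M" "finite N"
    using assms(1-3) simple_graph_finite_edges finite_subset by blast+
  then have "sum f ((M - edges_in M C) \<union> edges_in N C)
    = sum f (M - edges_in M C) + sum f (edges_in N C)"
    by (intro sum.union_disjoint) (auto simp: edges_in_def)
  also have "sum f (M - edges_in M C) = sum f M - sum f (edges_in M C)"
    using fin by (intro sum_diff) (auto simp: edges_in_def)
  finally show ?thesis .
qed

section \<open>Edmonds' dual program\<close>

definition odd_sets :: "'v set \<Rightarrow> 'v set set" where
  "odd_sets V = {U \<in> Pow V. odd (card U)}"

definition dual_load :: "'v set \<Rightarrow> ('v \<Rightarrow> int) \<Rightarrow> ('v set \<Rightarrow> int) \<Rightarrow> 'v set \<Rightarrow> int" where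
  "dual_load V y z e = (\<Sum>v\<in>e. y v) + (\<Sum>U\<in>{U \<in> odd_sets V. e \<subseteq> U}. z U)"

text \<open>The coefficient \<open>card U div 2\<close> is the right-hand side of Edmonds'
  inequality, the largest number of disjoint edges that fit into \<open>U\<close>. Singletons are
  harmless: their coefficient is 0 and they contain no edge.\<close>

definition dual_value :: "'v set \<Rightarrow> ('v \<Rightarrow> int) \<Rightarrow> ('v set \<Rightarrow> int) \<Rightarrow> int" where
  "dual_value V y z = (\<Sum>v\<in>V. y v) + (\<Sum>U\<in>odd_sets V. z U * int (card U div 2))"

lemma finite_odd_sets: "finite V \<Longrightarrow> finite (odd_sets V)"
  by (simp add: odd_sets_def)

lemma sum_fun_upd_plus_one:
  fixes f :: "'a \<Rightarrow> int"
  assumes "finite A"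
  shows "sum (f(u := f u + 1)) A = sum f A + of_bool (u \<in> A)"
proof (cases "u \<in> A")
  case True
  have "sum (f(u := f u + 1)) (A - {u}) = sum f (A - {u})" by (intro sum.cong) auto
  then show ?thesis using sum.remove[OF assms True, of "f(u := f u + 1)"]
      sum.remove[OF assms True, of f] True by simp
next
  case False
  then show ?thesis by (auto intro: sum.cong)
qed

lemma dual_raise_vertex:
  assumes "finite V" "u \<in> V"
  shows "finite e \<Longrightarrow> dual_load V (y(u := y u + 1)) z e = dual_load V y z e + of_bool (u \<in> e)"
    and "dual_value V (y(u := y u + 1)) z = dual_value V y z + 1"
  using assms unfolding dual_load_def dual_value_def by (simp_all only: sum_fun_upd_plus_one) auto

lemma dual_raise_odd_set:
  assumes "finite V" "U \<in> odd_sets V"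
  shows "dual_load V y (z(U := z U + 1)) e = dual_load V y z e + of_bool (e \<subseteq> U)"
    and "dual_value V y (z(U := z U + 1)) = dual_value V y z + int (card U div 2)"
proof -
  show "dual_load V y (z(U := z U + 1)) e = dual_load V y z e + of_bool (e \<subseteq> U)"
    using assms unfolding dual_load_def
    by (subst sum_fun_upd_plus_one) (auto simp: finite_odd_sets)
  have "(\<Sum>X\<in>odd_sets V - {U}. (z(U := z U + 1)) X * int (card X div 2))
    = (\<Sum>X\<in>odd_sets V - {U}. z X * int (card X div 2))" by (intro sum.cong) auto
  then show "dual_value V y (z(U := z U + 1)) = dual_value V y z + int (card U div 2)"
    using assms unfolding dual_value_def
    by (simp add: sum.remove[OF finite_odd_sets[OF assms(1)] assms(2)] algebra_simps)
qed

section \<open>Strong duality for maximum-weight matchings\<close>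

text \<open>Only the direction that weak duality does not supply is demanded; it makes
  \<open>N\<close> a maximum-weight matching and \<open>y\<close>, \<open>z\<close> an optimal dual.
  Integer duals suffice because each inductive step raises one variable by exactly one.\<close>

definition has_dual :: "'v set \<Rightarrow> 'v set set \<Rightarrow> ('v set \<Rightarrow> int) \<Rightarrow> bool" where
  "has_dual V E w \<longleftrightarrow> (\<exists>y z N. matching E N \<and> (\<forall>v. 0 \<le> y v) \<and> (\<forall>U. 0 \<le> z U) \<and>
     (\<forall>e\<in>E. w e \<le> dual_load V y z e) \<and> dual_value V y z \<le> sum w N)"

lemma has_dualE:
  assumes "has_dual V E w"
  obtains y z N where "matching E N" "\<And>v. 0 \<le> y v" "\<And>U. 0 \<le> z U"
    "\<And>e. e \<in> E \<Longrightarrow> w e \<le> dual_load V y z e" "dual_value V y z \<le> sum w N"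
  using assms unfolding has_dual_def by (elim exE conjE) (rule that; simp)

lemma sum_minus_one_on:
  fixes w :: "'e \<Rightarrow> int"
  assumes "finite N"
  shows "(\<Sum>e\<in>N. w e - of_bool (P e)) = sum w N - int (card {e \<in> N. P e})"
  using assms by (simp add: sum_subtractf Int_def of_bool_def sum.If_cases flip: sum.inter_filter)

text \<open>Lowering the edges at \<open>u\<close> lowers the optimum by at least one: a matching
  that covers \<open>u\<close> loses one unit, and a matching that misses \<open>u\<close> was not
  optimal, hence already one unit short by integrality. Raising \<open>y u\<close> by one pays for
  exactly this.\<close>

lemma has_dual_vertex_step:
  assumes sg: "simple_graph V E" and u: "u \<in> V"
    and N: "matching E N" "\<And>N'. matching E N' \<Longrightarrow> sum w N' \<le> sum w N"
    and cov: "\<And>N'. matching E N' \<Longrightarrow> sum w N' = sum w N \<Longrightarrow> u \<in> \<Union>N'"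
    and IH: "has_dual V E (\<lambda>e. w e - of_bool (u \<in> e))"
  shows "has_dual V E w"
proof -
  obtain y z N' where d: "matching E N'" "\<And>v. 0 \<le> y v" "\<And>U. 0 \<le> z U"
    "\<And>e. e \<in> E \<Longrightarrow> w e - of_bool (u \<in> e) \<le> dual_load V y z e"
    "dual_value V y z \<le> (\<Sum>e\<in>N'. w e - of_bool (u \<in> e))"
    using IH by (rule has_dualE) (rule that; simp)
  have finV: "finite V" using sg by (simp add: simple_graph_def)
  have finN': "finite N'"
    using d(1) simple_graph_finite_edges[OF sg] finite_subset unfolding matching_def by blast
  have "(\<Sum>e\<in>N'. w e - of_bool (u \<in> e)) + 1 \<le> sum w N"
  proof (cases "u \<in> \<Union>N'")
    case True
    then have "{e \<in> N'. u \<in> e} \<noteq> {}" by auto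
    then have "0 < card {e \<in> N'. u \<in> e}" using finN' by (simp add: card_gt_0_iff)
    then show ?thesis using sum_minus_one_on[OF finN', of w "\<lambda>e. u \<in> e"] N(2)[OF d(1)] by simp
  next
    case False
    then have "sum w N' < sum w N" using cov[OF d(1)] N(2)[OF d(1)] by force
    moreover have "{e \<in> N'. u \<in> e} = {}" using False by auto
    ultimately show ?thesis using sum_minus_one_on[OF finN', of w "\<lambda>e. u \<in> e"] by simp
  qed
  then have "dual_value V (y(u := y u + 1)) z \<le> sum w N"
    using d(5) dual_raise_vertex(2)[OF finV u] by simp
  moreover have "w e \<le> dual_load V (y(u := y u + 1)) z e" if "e \<in> E" for e
    using d(4)[OF that] dual_raise_vertex(1)[OF finV u edge_props(3)[OF sg that]] by simp
  moreover have "0 \<le> (y(u := y u + 1)) v" for v using d(2)[of v] d(2)[of u] by simp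
  ultimately show ?thesis using N(1) d(3) unfolding has_dual_def by blast
qed

text \<open>
  Gallai's lemma in weighted form. Here \<open>M\<close> is optimal for the lowered weight and, subject to this, of maximum
  size. Missing no common pair is a transitive relation on the vertices, because any two vertices missed
  by \<open>M\<close> can be traded for one of them together with \<open>t\<close>.
\<close>
lemma optimal_matching_misses_at_most_one:
  fixes w :: "'v set \<Rightarrow> int"
  assumes sg: "simple_graph V E" and pos: "\<And>e. e \<in> E \<Longrightarrow> 1 \<le> w e"
    and r: "r \<in> V"
  defines "U \<equiv> {x. (r, x) \<in> (adjacency E)\<^sup>*}"
  defines "w' \<equiv> (\<lambda>e. w e - of_bool (e \<subseteq> U))"
  assumes miss: "\<And>t. t \<in> U \<Longrightarrow> \<exists>N. matching E N \<and> (\<forall>N'. matching E N' \<longrightarrow> sum w N' \<le> sum w N)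
            \<and> t \<notin> \<Union>N"
  defines "opt \<equiv> (\<lambda>M. matching E M \<and> (\<forall>N. matching E N \<longrightarrow> sum w' N \<le> sum w' M) \<and>
     (\<forall>N. matching E N \<longrightarrow> sum w' N = sum w' M \<longrightarrow> card N \<le> card M))"
  assumes M: "opt M" and uv: "u \<in> U" "v \<in> U" "u \<noteq> v"
  shows "u \<in> \<Union>M \<or> v \<in> \<Union>M"
proof -
  \<comment> \<open>All optimal matchings are quantified over because transitivity applies the
    relation to an exchanged matching, not to the given one.\<close>
  define rel where "rel = (\<lambda>a b. \<forall>M. opt M \<longrightarrow> a = b \<or> a \<in> \<Union>M \<or> b \<in> \<Union>M)"
  have finE: "finite E" using sg simple_graph_finite_edges by blast
  have UV: "U \<subseteq> V" using card_le_edges_of_connected(2)[OF sg r] by (simp add: U_def)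
  have finM: "finite M" if "matching E M" for M
    using that finE finite_subset unfolding matching_def by blast
  have step: "rel a b" if "(a, b) \<in> adjacency E" for a b
    unfolding rel_def
  proof (intro allI impI, rule ccontr)
    fix M assume M: "opt M" and "\<not> (a = b \<or> a \<in> \<Union>M \<or> b \<in> \<Union>M)"
    then have n: "a \<notin> \<Union>M" "b \<notin> \<Union>M" by auto
    have e: "{a, b} \<in> E" using that by (simp add: adjacency_def)
    have mM: "matching E M" using M by (simp add: opt_def)
    have mi: "matching E (insert {a, b} M)"
      using mM e n by (auto simp: matching_def pairwise_insert disjnt_def)
    have ni: "{a, b} \<notin> M" using n by auto
    \<comment> \<open>The lowered weight may be 0, so adding the edge need not improve
      \<open>w'\<close>; the maximal size in \<open>opt\<close> settles this tie.\<close>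
    have "0 \<le> w' {a, b}" using pos[OF e] by (simp add: w'_def)
    then have "sum w' (insert {a, b} M) \<ge> sum w' M" using ni finM[OF mM] by simp
    moreover have "sum w' (insert {a, b} M) \<le> sum w' M" using M mi by (simp add: opt_def)
    ultimately have "card (insert {a, b} M) \<le> card M" using M mi unfolding opt_def by force
    then show False using ni finM[OF mM] by simp
  qed
  have trans: "rel a b" if "rel a t" "rel t b" "t \<in> U" for a t b
    unfolding rel_def
  proof (intro allI impI, rule ccontr)
    fix M assume M: "opt M" and "\<not> (a = b \<or> a \<in> \<Union>M \<or> b \<in> \<Union>M)"
    then have n: "a \<noteq> b" "a \<notin> \<Union>M" "b \<notin> \<Union>M" by auto
    have tM: "t \<in> \<Union>M" using that(1,2) M n unfolding rel_def by blast
    obtain N where N: "matching E N" "\<And>N'. matching E N' \<Longrightarrow> sum w N' \<le> sum w N" "t \<notin> \<Union>N"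
      using miss[OF \<open>t \<in> U\<close>] by blast
    have mM: "matching E M" using M by (simp add: opt_def)
    have tV: "t \<in> V" using UV that(3) by blast
    obtain C where C: "t \<in> C" "\<And>e. e \<in> M \<union> N \<Longrightarrow> e \<subseteq> C \<or> e \<inter> C = {}"
      "card (edges_in N C) \<le> card (edges_in M C)" "a \<notin> C \<or> b \<notin> C"
      "C \<subseteq> {x. (t, x) \<in> (adjacency E)\<^sup>*}"
      using exchange_component[OF sg mM N(1) tV N(3) n] by blast
    have CU: "C \<subseteq> U" using C(5) that(3) by (auto simp: U_def)
    have C2': "\<And>e. e \<in> N \<union> M \<Longrightarrow> e \<subseteq> C \<or> e \<inter> C = {}" using C(2) by blast
    define M' where "M' = (M - edges_in M C) \<union> edges_in N C"
    define N' where "N' = (N - edges_in N C) \<union> edges_in M C"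
    have mM': "matching E M'" using matching_swap[OF mM N(1) C(2)] by (simp add: M'_def)
    have mN': "matching E N'" using matching_swap[OF N(1) mM C2'] by (simp add: N'_def)
    have sub: "M \<subseteq> E" "N \<subseteq> E" using mM N(1) by (auto simp: matching_def)
    note sM' = sum_swap[OF sg sub C(2), folded M'_def]
    have "sum w N' \<le> sum w N" using N(2)[OF mN'] .
    then have le: "sum w (edges_in M C) \<le> sum w (edges_in N C)"
      using sum_swap[OF sg sub(2,1) C2', of w, folded N'_def] by simp
    have red: "sum w' (edges_in X C) = sum w (edges_in X C) - int (card (edges_in X C))"
      if "X \<subseteq> E" for X
    proof -
      have "sum w' (edges_in X C) = (\<Sum>e\<in>edges_in X C. w e - 1)"
        using CU by (intro sum.cong) (auto simp: w'_def edges_in_def)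
      then show ?thesis by (simp add: sum_subtractf)
    qed
    \<comment> \<open>Every edge inside \<open>C\<close> is lowered by one, so the gain
      \<open>sum w' M' - sum w' M\<close> is the gain in \<open>w\<close> plus the drop in the
      number of edges inside \<open>C\<close>. Both are nonnegative and their sum is at most 0, so
      both vanish.\<close>
    have "sum w' M' \<le> sum w' M" using M mM' by (simp add: opt_def)
    then have eq: "sum w' M' = sum w' M" "card (edges_in N C) = card (edges_in M C)"
      using sM'[of w'] red[OF sub(1)] red[OF sub(2)] le C(3) by linarith+
    have "int (card M') = int (card M)"
      using sM'[of "\<lambda>_. 1::int"] eq(2) by simp
    then have "opt M'" using M mM' eq(1) by (simp add: opt_def)
    \<comment> \<open>Inside \<open>C\<close> the new matching agrees with \<open>N\<close>, which
      misses \<open>t\<close>; outside it agrees with \<open>M\<close>, so whichever of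
      \<open>a\<close>, \<open>b\<close> lies outside \<open>C\<close> stays missed.\<close>
    moreover have "t \<notin> \<Union>M'" using N(3) C(1,2) by (auto simp: M'_def edges_in_def)
    moreover have "a \<notin> \<Union>M' \<or> b \<notin> \<Union>M'" using C(4) n(2,3) by (auto simp: M'_def edges_in_def)
    moreover have "t \<noteq> a" "t \<noteq> b" using tM n by auto
    ultimately show False using that(1,2) unfolding rel_def by blast
  qed
  have sym: "sym ((adjacency E)\<^sup>*)"
    by (intro sym_rtrancl) (auto simp: sym_def adjacency_def insert_commute)
  have "(u, v) \<in> (adjacency E)\<^sup>*" using uv sym unfolding U_def
    by (metis mem_Collect_eq rtrancl_trans symD)
  moreover have "x \<in> U" if "(u, x) \<in> (adjacency E)\<^sup>*" for x
    using that uv(1) by (auto simp: U_def)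
  ultimately have "rel u v"
  proof (induction)
    case base then show ?case by (simp add: rel_def)
  next
    case (step x y)
    then show ?case using trans[of u x y] \<open>\<And>a b. (a, b) \<in> adjacency E \<Longrightarrow> rel a b\<close> by blast
  qed
  then show ?thesis using M uv(3) unfolding rel_def by blast
qed

text \<open>An optimum \<open>M\<close> for the lowered weight, chosen of maximum size, misses
  exactly one vertex of \<open>U\<close>. So \<open>U\<close> is odd and \<open>M\<close> has
  \<open>card U div 2\<close> edges inside: restoring the weights gains for \<open>M\<close>
  precisely what raising \<open>z U\<close> by one costs.\<close>

lemma has_dual_odd_set_step:
  fixes w :: "'v set \<Rightarrow> int"
  assumes sg: "simple_graph V E" and pos: "\<And>e. e \<in> E \<Longrightarrow> 1 \<le> w e"
    and r: "r \<in> V"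
  defines "U \<equiv> {x. (r, x) \<in> (adjacency E)\<^sup>*}"
  assumes miss: "\<And>t. t \<in> V \<Longrightarrow> \<exists>N. matching E N \<and> (\<forall>N'. matching E N' \<longrightarrow> sum w N' \<le> sum w N)
            \<and> t \<notin> \<Union>N"
    and IH: "has_dual V E (\<lambda>e. w e - of_bool (e \<subseteq> U))"
  shows "has_dual V E w"
proof -
  define w' where "w' = (\<lambda>e. w e - of_bool (e \<subseteq> U))"
  have finE: "finite E" using sg simple_graph_finite_edges by blast
  have finV: "finite V" using sg by (simp add: simple_graph_def)
  have UV: "U \<subseteq> V" using card_le_edges_of_connected(2)[OF sg r] by (simp add: U_def)
  have finU: "finite U" using UV finV finite_subset by blast
  have rU: "r \<in> U" by (simp add: U_def)
  have w'_sum: "sum w' N = sum w N - int (card (edges_in N U))" if "matching E N" for N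
    using that sum_minus_one_on[of N w "\<lambda>e. e \<subseteq> U"] finE finite_subset
    unfolding matching_def w'_def edges_in_def by blast
  define \<M> where "\<M> = {M. matching E M}"
  have "\<M> \<subseteq> Pow E" by (auto simp: \<M>_def matching_def)
  then have fin\<M>: "finite \<M>" using finE finite_subset by blast
  have "{} \<in> \<M>" by (simp add: \<M>_def matching_def)
  then obtain M0 where M0: "M0 \<in> \<M>" "\<And>N. N \<in> \<M> \<Longrightarrow> sum w' N \<le> sum w' M0"
    using finite_has_argmax[of \<M> "sum w'"] fin\<M> by blast
  define \<O> where "\<O> = {M \<in> \<M>. sum w' M = sum w' M0}"
  have "finite \<O>" "\<O> \<noteq> {}" using fin\<M> M0(1) by (auto simp: \<O>_def)
  then obtain M where M: "M \<in> \<O>" "\<And>N. N \<in> \<O> \<Longrightarrow> card N \<le> card M"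
    using finite_has_argmax[of \<O> card] by blast
  have mM: "matching E M" using M by (simp add: \<O>_def \<M>_def)
  have maxM: "sum w' N \<le> sum w' M" if "matching E N" for N
    using M0(2)[of N] M(1) that by (simp add: \<O>_def \<M>_def)
  have cardM: "card N \<le> card M" if "matching E N" "sum w' N = sum w' M" for N
    using M(2)[of N] M(1) that by (simp add: \<O>_def \<M>_def)
  have one: "u \<in> \<Union>M \<or> v \<in> \<Union>M" if "u \<in> U" "v \<in> U" "u \<noteq> v" for u v
    by (rule optimal_matching_misses_at_most_one[where M = M and w = w, OF sg pos r])
      (use that miss UV mM maxM cardM in \<open>auto simp flip: U_def simp: w'_def\<close>)
  have cover: "\<Union>(edges_in M U) = U \<inter> \<Union>M"
  proof -
    have "e \<subseteq> U \<or> e \<inter> U = {}" if "e \<in> M" for e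
      using component_closed[OF sg, of e r] that mM by (auto simp: U_def matching_def)
    then show ?thesis by (fastforce simp: edges_in_def)
  qed
  have cardMU: "2 * card (edges_in M U) = card (U \<inter> \<Union>M)"
    using card_edges_in_subset[OF sg mM, of U] cover by simp
  obtain N where N: "matching E N" "\<And>N'. matching E N' \<Longrightarrow> sum w N' \<le> sum w N" "r \<notin> \<Union>N"
    using miss[OF r] by blast
  \<comment> \<open>If \<open>M\<close> covered \<open>U\<close>, it would have more edges in
    \<open>U\<close> than \<open>N\<close>, which misses \<open>r\<close>. Being no worse than
    \<open>N\<close> for \<open>w'\<close>, it would then beat \<open>N\<close> for
    \<open>w\<close>.\<close>
  have "U - \<Union>M \<noteq> {}"
  proof
    assume "U - \<Union>M = {}"
    then have full: "2 * card (edges_in M U) = card U" using cardMU by (simp add: Int_absorb2)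
    have "\<Union>(edges_in N U) \<subset> U" using N(3) rU by (auto simp: edges_in_def)
    then have "card (\<Union>(edges_in N U)) < card U" using finU psubset_card_mono by blast
    then have "card (edges_in N U) < card (edges_in M U)"
      using full card_edges_in_subset[OF sg N(1), of U] by simp
    moreover have "sum w' N \<le> sum w' M" using maxM[OF N(1)] .
    ultimately have "sum w N < sum w M" using w'_sum[OF N(1)] w'_sum[OF mM] by simp
    then show False using N(2)[OF mM] by simp
  qed
  then obtain m where m: "m \<in> U" "m \<notin> \<Union>M" by blast
  then have "U \<inter> \<Union>M = U - {m}" using one by blast
  then have cardU: "card U = 2 * card (edges_in M U) + 1"
    using cardMU m(1) finU card_Suc_Diff1[of U m] by simp
  then have Uodd: "U \<in> odd_sets V" using UV by (simp add: odd_sets_def)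
  obtain y z N' where d: "matching E N'" "\<And>v. 0 \<le> y v" "\<And>X. 0 \<le> z X"
    "\<And>e. e \<in> E \<Longrightarrow> w' e \<le> dual_load V y z e" "dual_value V y z \<le> sum w' N'"
    using IH[folded w'_def] by (rule has_dualE) (rule that; simp)
  have "dual_value V y (z(U := z U + 1)) \<le> sum w M"
    using d(5) maxM[OF d(1)] w'_sum[OF mM] cardU dual_raise_odd_set(2)[OF finV Uodd, of y z] by simp
  moreover have "w e \<le> dual_load V y (z(U := z U + 1)) e" if "e \<in> E" for e
    using d(4)[OF that] dual_raise_odd_set(1)[OF finV Uodd, of y z e] by (simp add: w'_def)
  moreover have "0 \<le> (z(U := z U + 1)) X" for X using d(3)[of X] d(3)[of U] by simp
  ultimately show ?thesis using mM d(2) unfolding has_dual_def by blast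
qed

theorem weighted_matching_duality:
  assumes "simple_graph V E"
  shows "has_dual V E w"
  using assms
\<comment> \<open>The summand \<open>card E\<close> pays for deleting an edge of nonpositive weight,
  which leaves the sum of the \<open>nat (w e)\<close> unchanged.\<close>
proof (induction "card E + (\<Sum>e\<in>E. nat (w e))" arbitrary: E w rule: less_induct)
  case less
  note sg = less.prems
  have finE: "finite E" using sg simple_graph_finite_edges by blast
  consider e where "e \<in> E" "w e \<le> 0" | "E = {}" | "E \<noteq> {}" "\<And>e. e \<in> E \<Longrightarrow> 1 \<le> w e" by force
  then show ?case
  proof cases
    case 1
    have "card (E - {e}) < card E" using 1(1) finE by (meson card_Diff1_less)
    moreover have "(\<Sum>e\<in>E - {e}. nat (w e)) \<le> (\<Sum>e\<in>E. nat (w e))"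
      using finE by (intro sum_mono2) auto
    ultimately have "card (E - {e}) + (\<Sum>e\<in>E - {e}. nat (w e)) < card E + (\<Sum>e\<in>E. nat (w e))"
      by (rule add_less_le_mono)
    then have "has_dual V (E - {e}) w"
      by (rule less.hyps) (rule simple_graph_subset[OF sg Diff_subset])
    then obtain y z N where d: "matching (E - {e}) N" "\<And>v. 0 \<le> y v" "\<And>X. 0 \<le> z X"
      "\<And>f. f \<in> E - {e} \<Longrightarrow> w f \<le> dual_load V y z f" "dual_value V y z \<le> sum w N"
      by (rule has_dualE) (rule that; simp)
    \<comment> \<open>Nonnegative duals satisfy the constraint of the deleted edge
      automatically.\<close>
    have "0 \<le> dual_load V y z e" using d(2,3) by (simp add: dual_load_def sum_nonneg)
    then have "\<forall>f\<in>E. w f \<le> dual_load V y z f" using d(4) 1(2) by force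
    moreover have "matching E N" using d(1) by (auto simp: matching_def)
    ultimately show ?thesis using d(2,3,5) unfolding has_dual_def by blast
  next
    case 2
    then show ?thesis unfolding has_dual_def matching_def dual_value_def
      by (intro exI[of _ "\<lambda>_. 0"] exI[of _ "{}"]) auto
  next
    case 3
    \<comment> \<open>All weights are at least 1 here, so the lowered weights stay nonnegative and
      \<open>nat\<close> registers the drop at \<open>f\<close>.\<close>
    have lower: "has_dual V E (\<lambda>e. w e - of_bool (P e))" if "f \<in> E" "P f" for P f
    proof (rule less.hyps[OF _ sg])
      have "(\<Sum>e\<in>E. nat (w e - of_bool (P e))) < (\<Sum>e\<in>E. nat (w e))"
        using that 3(2)[OF that(1)] finE by (intro sum_strict_mono_ex1) (auto intro!: bexI[of _ f])
      then show "card E + (\<Sum>e\<in>E. nat (w e - of_bool (P e))) < card E + (\<Sum>e\<in>E. nat (w e))"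
        by simp
    qed
    define \<M> where "\<M> = {N. matching E N}"
    have "finite \<M>"
      by (rule finite_subset[of _ "Pow E"]) (auto simp: \<M>_def matching_def finE)
    moreover have "{} \<in> \<M>" by (simp add: \<M>_def matching_def)
    ultimately obtain N where "N \<in> \<M>" "\<And>N'. N' \<in> \<M> \<Longrightarrow> sum w N' \<le> sum w N"
      using finite_has_argmax[of \<M> "sum w"] by blast
    then have N: "matching E N" "\<And>N'. matching E N' \<Longrightarrow> sum w N' \<le> sum w N"
      by (simp_all add: \<M>_def)
    show ?thesis
    proof (cases "\<exists>u\<in>V. \<forall>N'. matching E N' \<longrightarrow> sum w N' = sum w N \<longrightarrow> u \<in> \<Union>N'")
      case True
      then obtain u where u: "u \<in> V"
        "\<And>N'. matching E N' \<Longrightarrow> sum w N' = sum w N \<Longrightarrow> u \<in> \<Union>N'" by blast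
      obtain f where "f \<in> E" "u \<in> f" using u(2)[OF N(1)] N(1) by (auto simp: matching_def)
      then have IH: "has_dual V E (\<lambda>e. w e - of_bool (u \<in> e))" by (rule lower)
      show ?thesis
        by (rule has_dual_vertex_step[OF sg u(1) N(1)]) (erule N(2) | erule (1) u(2) | rule IH)+
    next
      case False
      obtain f where f: "f \<in> E" using 3(1) by blast
      then obtain r where rf: "r \<in> f" using edge_props(4)[OF sg] by blast
      then have r: "r \<in> V" using edge_props(1)[OF sg f] by blast
      have miss: "\<exists>N. matching E N \<and> (\<forall>N'. matching E N' \<longrightarrow> sum w N' \<le> sum w N) \<and> t \<notin> \<Union>N"
        if "t \<in> V" for t
      proof -
        obtain N' where "matching E N'" "sum w N' = sum w N" "t \<notin> \<Union>N'" using False \<open>t \<in> V\<close> by blast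
        then show ?thesis using N(2) by (intro exI[of _ N']) simp
      qed
      have "f \<subseteq> {x. (r, x) \<in> (adjacency E)\<^sup>*}"
        using component_closed[OF sg f, of r] rf by auto
      then have IH: "has_dual V E (\<lambda>e. w e - of_bool (e \<subseteq> {x. (r, x) \<in> (adjacency E)\<^sup>*}))"
        by (rule lower[OF f])
      show ?thesis
        by (rule has_dual_odd_set_step[OF sg _ r]) (erule 3(2) | erule miss | rule IH)+
    qed
  qed
qed

section \<open>Perfect matchings and slack constraints\<close>

lemma perfect_matching_iff:
  assumes "simple_graph V E"
  shows "M \<in> perfect_matchings V E \<longleftrightarrow> matching E M \<and> \<Union>M = V"
proof
  assume M: "M \<in> perfect_matchings V E"
  then have "M \<subseteq> E" by (simp add: perfect_matchings_def)
  then have "\<Union>M \<subseteq> V" using edge_props(1)[OF assms] by blast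
  then show "matching E M \<and> \<Union>M = V"
    using M unfolding perfect_matchings_def matching_def pairwise_def disjnt_def by blast
next
  assume "matching E M \<and> \<Union>M = V"
  then show "M \<in> perfect_matchings V E"
    unfolding perfect_matchings_def matching_def pairwise_def disjnt_def by blast
qed

lemma card_matching:
  assumes "simple_graph V E" "matching E M"
  shows "2 * card M = card (\<Union>M)"
proof -
  have "edges_in M V = M"
    using assms edge_props(1)[OF assms(1)] by (auto simp: edges_in_def matching_def)
  then show ?thesis using card_edges_in_subset[OF assms, of V] by simp
qed

text \<open>Double counting. The vertex part is the same for all perfect matchings, so the load
  differs from \<open>dual_value\<close> only where \<open>card (edges_in M U)\<close> differs from
  \<open>card U div 2\<close>.\<close>

lemma sum_dual_load_perfect_matching:
  assumes sg: "simple_graph V E" and M: "M \<in> perfect_matchings V E"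
  shows "sum (dual_load V y z) M
    = (\<Sum>v\<in>V. y v) + (\<Sum>U\<in>odd_sets V. z U * int (card (edges_in M U)))"
proof -
  have m: "matching E M" "\<Union>M = V" using M perfect_matching_iff[OF sg] by auto
  have ME: "M \<subseteq> E" using m(1) by (simp add: matching_def)
  have finV: "finite V" using sg by (simp add: simple_graph_def)
  have finM: "finite M" using ME simple_graph_finite_edges[OF sg] finite_subset by blast
  have "sum y (\<Union>M) = (\<Sum>e\<in>M. \<Sum>v\<in>e. y v)"
    using m(1) ME edge_props(3)[OF sg]
    by (subst sum.Union_disjoint) (auto simp: matching_def pairwise_def disjnt_def)
  moreover have "(\<Sum>e\<in>M. \<Sum>U\<in>{U \<in> odd_sets V. e \<subseteq> U}. z U)
    = (\<Sum>U\<in>odd_sets V. \<Sum>e\<in>{e \<in> M. e \<subseteq> U}. z U)"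
    using finM finite_odd_sets[OF finV] by (rule sum.swap_restrict)
  ultimately show ?thesis
    using m(2) by (simp add: dual_load_def sum.distrib edges_in_def mult.commute)
qed

text \<open>\<open>X\<close> collects vertices of \<open>U\<close> not matched inside
  \<open>U\<close>. Empty \<open>X\<close> gives Edmonds' inequality; a two-element \<open>X\<close>
  makes it strict.\<close>

lemma matching_edges_in_odd_set:
  assumes sg: "simple_graph V E" and M: "matching E M" and U: "finite U"
    and X: "X \<subseteq> U" "X \<inter> \<Union>(edges_in M U) = {}"
  shows "2 * card (edges_in M U) + card X \<le> card U"
proof -
  have "\<Union>(edges_in M U) \<subseteq> U" by (auto simp: edges_in_def)
  then have "card (\<Union>(edges_in M U) \<union> X) \<le> card U" using X U by (intro card_mono) auto
  moreover have "card (\<Union>(edges_in M U) \<union> X) = card (\<Union>(edges_in M U)) + card X"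
    using X U \<open>\<Union>(edges_in M U) \<subseteq> U\<close> by (intro card_Un_disjoint) (auto intro: finite_subset)
  ultimately show ?thesis using card_edges_in_subset[OF sg M, of U] by simp
qed

text \<open>Slack at \<open>U\<close> yields two vertices \<open>a\<close>, \<open>b\<close> of
  \<open>U\<close> that \<open>M\<close> matches to the outside. A perfect matching containing these
  two edges must match \<open>a\<close> and \<open>b\<close> by them, so it is slack at
  \<open>U\<close> as well.\<close>

lemma two_crossing_edges:
  assumes sg: "simple_graph V E" and M: "M \<in> perfect_matchings V E" and U: "U \<subseteq> V"
    and less: "card (edges_in M U) < card U div 2"
  obtains F where "F \<subseteq> M" "card F \<le> 2"
    "\<And>M'. M' \<in> perfect_matchings V E \<Longrightarrow> F \<subseteq> M' \<Longrightarrow> 2 * card (edges_in M' U) + 2 \<le> card U"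
proof -
  have m: "matching E M" "\<Union>M = V" using M perfect_matching_iff[OF sg] by auto
  have finU: "finite U" using sg U finite_subset by (auto simp: simple_graph_def)
  define X where "X = U - \<Union>(edges_in M U)"
  have "card X = card U - card (\<Union>(edges_in M U))"
    unfolding X_def using finU
    by (intro card_Diff_subset) (auto simp: edges_in_def intro: finite_subset[of _ U])
  then have "2 \<le> card X" using less card_edges_in_subset[OF sg m(1), of U] by simp
  then obtain a b where ab: "a \<in> X" "b \<in> X" "a \<noteq> b"
    by (metis card_2_iff' obtain_subset_with_card_n subsetD)
  then obtain e f where ef: "e \<in> M" "f \<in> M" "a \<in> e" "b \<in> f" using m(2) U unfolding X_def by blast
  have out: "\<not> e \<subseteq> U" "\<not> f \<subseteq> U" using ab ef by (auto simp: X_def edges_in_def)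
  show ?thesis
  proof (rule that[of "{e, f}"])
    show "{e, f} \<subseteq> M" using ef by simp
    show "card {e, f} \<le> 2" by (simp add: card_insert_if)
    fix M' assume M': "M' \<in> perfect_matchings V E" "{e, f} \<subseteq> M'"
    have m': "matching E M'" using M' perfect_matching_iff[OF sg] by auto
    have "g = e" if "g \<in> M'" "a \<in> g" for g
      using m' that M'(2) ef(3) by (auto simp: matching_def pairwise_def disjnt_def)
    moreover have "g = f" if "g \<in> M'" "b \<in> g" for g
      using m' that M'(2) ef(4) by (auto simp: matching_def pairwise_def disjnt_def)
    ultimately have "{a, b} \<inter> \<Union>(edges_in M' U) = {}" using out by (auto simp: edges_in_def)
    then have "2 * card (edges_in M' U) + card {a, b} \<le> card U"
      using ab by (intro matching_edges_in_odd_set[OF sg m' finU]) (auto simp: X_def)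
    then show "2 * card (edges_in M' U) + 2 \<le> card U" using ab(3) by simp
  qed
qed

lemma abs_sum_le_total:
  fixes w :: "'e \<Rightarrow> int"
  assumes "finite E" "M \<subseteq> E"
  shows "\<bar>sum w M\<bar> \<le> (\<Sum>e\<in>E. \<bar>w e\<bar>)"
proof -
  have "(\<Sum>e\<in>M. \<bar>w e\<bar>) \<le> (\<Sum>e\<in>E. \<bar>w e\<bar>)" using assms by (intro sum_mono2) auto
  then show ?thesis using sum_abs[of w M] by linarith
qed

lemma nonminimal_excluded_by_two_edges:
  fixes w :: "'v set \<Rightarrow> int"
  assumes sg: "simple_graph V E" and M: "M \<in> perfect_matchings V E"
    and notmin: "\<exists>N\<in>perfect_matchings V E. sum w N < sum w M"
  obtains F where "F \<subseteq> M" "card F \<le> 2"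
    "\<And>M'. M' \<in> perfect_matchings V E \<Longrightarrow> F \<subseteq> M' \<Longrightarrow>
       \<exists>N\<in>perfect_matchings V E. sum w N < sum w M'"
proof -
  define B where "B = (\<Sum>e\<in>E. \<bar>w e\<bar>)"
  define K where "K = 2 * B + 1"
  \<comment> \<open>The offset \<open>K\<close> is so large that maximum-weight matchings for \<open>c\<close> are the minimum-weight
     perfect matchings for \<open>w\<close>.\<close>
  define c where "c = (\<lambda>e. K - w e)"
  have finE: "finite E" using sg simple_graph_finite_edges by blast
  have finV: "finite V" using sg by (simp add: simple_graph_def)
  have c_sum: "sum c N = K * int (card N) - sum w N" for N
    by (simp add: c_def sum_subtractf)
  have pm: "matching E N" "N \<subseteq> E" "2 * card N = card V" if "N \<in> perfect_matchings V E" for N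
    using that perfect_matching_iff[OF sg] card_matching[OF sg] by (auto simp: matching_def)
  obtain y z N where d: "matching E N" "\<And>v. 0 \<le> y v" "\<And>X. 0 \<le> z X"
    "\<And>e. e \<in> E \<Longrightarrow> c e \<le> dual_load V y z e" "dual_value V y z \<le> sum c N"
    using weighted_matching_duality[OF sg, of c] by (rule has_dualE) (rule that; simp)
  have weak: "sum c P \<le> dual_value V y z" if P: "P \<in> perfect_matchings V E" for P
  proof -
    have "sum c P \<le> sum (dual_load V y z) P" using d(4) pm(2)[OF P] by (intro sum_mono) blast
    also have "\<dots> \<le> dual_value V y z"
      unfolding sum_dual_load_perfect_matching[OF sg P] dual_value_def
    proof (intro add_left_mono sum_mono mult_left_mono d(3))
      fix U assume "U \<in> odd_sets V"
      then have "finite U" using finV finite_subset by (auto simp: odd_sets_def)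
      then show "int (card (edges_in P U)) \<le> int (card U div 2)"
        using matching_edges_in_odd_set[OF sg pm(1)[OF P], of U "{}"] by simp
    qed
    finally show ?thesis .
  qed
  have NE: "N \<subseteq> E" using d(1) by (simp add: matching_def)
  have NV: "\<Union>N \<subseteq> V" using NE edge_props(1)[OF sg] by blast
  have N_perfect: "N \<in> perfect_matchings V E"
  proof -
    \<comment> \<open>One missing edge would cost \<open>K\<close>, while the
      \<open>w\<close>-weights of two matchings differ by at most \<open>2 * B\<close>.\<close>
    have "card N \<ge> card M"
    proof (rule ccontr)
      assume "\<not> card M \<le> card N"
      then have "int (card N) + 1 \<le> int (card M)" by simp
      moreover have "0 \<le> K" by (simp add: K_def B_def sum_nonneg)
      ultimately have "K * (int (card N) + 1) \<le> K * int (card M)" by (intro mult_left_mono)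
      moreover have "sum c M \<le> sum c N" using weak[OF M] d(5) by simp
      ultimately have "K \<le> sum w M - sum w N" using c_sum[of M] c_sum[of N]
        by (simp add: algebra_simps)
      moreover have "\<bar>sum w M\<bar> \<le> B" "\<bar>sum w N\<bar> \<le> B"
        using abs_sum_le_total[OF finE] pm(2)[OF M] NE by (auto simp: B_def)
      ultimately show False by (simp add: K_def)
    qed
    then have "card V \<le> card (\<Union>N)" using pm(3)[OF M] card_matching[OF sg d(1)] by simp
    then have "\<Union>N = V" using NV finV by (simp add: card_seteq)
    then show ?thesis using d(1) perfect_matching_iff[OF sg] by simp
  qed
  have excluded: "\<exists>N\<in>perfect_matchings V E. sum w N < sum w P"
    if P: "P \<in> perfect_matchings V E" and "sum c P < dual_value V y z" for P
  proof -
    have "card P = card N" using pm(3)[OF P] pm(3)[OF N_perfect] by simp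
    then have "sum w N < sum w P" using that(2) d(5) c_sum[of P] c_sum[of N] by simp
    then show ?thesis using N_perfect by blast
  qed
  \<comment> \<open>Otherwise \<open>sum c M\<close> would reach the dual value, which bounds
    \<open>sum c P\<close> for every perfect matching \<open>P\<close>, contrary to
    \<open>notmin\<close>.\<close>
  have "(\<exists>e\<in>M. c e < dual_load V y z e) \<or>
    (\<exists>U\<in>odd_sets V. 0 < z U \<and> card (edges_in M U) < card U div 2)"
  proof (rule ccontr)
    assume neg: "\<not> ?thesis"
    have "dual_value V y z \<le> sum (dual_load V y z) M"
      unfolding sum_dual_load_perfect_matching[OF sg M] dual_value_def
    proof (intro add_left_mono sum_mono)
      fix U assume "U \<in> odd_sets V"
      then have "z U = 0 \<or> card U div 2 \<le> card (edges_in M U)" using neg d(3)[of U] by force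
      then show "z U * int (card U div 2) \<le> z U * int (card (edges_in M U))"
        using d(3)[of U] by (auto intro: mult_left_mono)
    qed
    also have "\<dots> \<le> sum c M" using neg by (intro sum_mono) force
    finally have le: "dual_value V y z \<le> sum c M" .
    obtain P where P: "P \<in> perfect_matchings V E" "sum w P < sum w M" using notmin by blast
    have "card P = card M" using pm(3)[OF P(1)] pm(3)[OF M] by simp
    then show False using le weak[OF P(1)] P(2) c_sum[of P] c_sum[of M] by simp
  qed
  then show ?thesis
  proof
    assume "\<exists>e\<in>M. c e < dual_load V y z e"
    then obtain e where e: "e \<in> M" "c e < dual_load V y z e" by blast
    show ?thesis
    proof (rule that[of "{e}"])
      show "{e} \<subseteq> M" "card {e} \<le> 2" using e by simp_all
      fix P assume P: "P \<in> perfect_matchings V E" "{e} \<subseteq> P"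
      have "sum c P < sum (dual_load V y z) P"
        using P(2) e(2) d(4) pm(2)[OF P(1)] finE
        by (intro sum_strict_mono_ex1) (auto intro: finite_subset)
      also have "\<dots> \<le> dual_value V y z"
        unfolding sum_dual_load_perfect_matching[OF sg P(1)] dual_value_def
      proof (intro add_left_mono sum_mono mult_left_mono d(3))
        fix U assume "U \<in> odd_sets V"
        then have "finite U" using finV finite_subset by (auto simp: odd_sets_def)
        then show "int (card (edges_in P U)) \<le> int (card U div 2)"
          using matching_edges_in_odd_set[OF sg pm(1)[OF P(1)], of U "{}"] by simp
      qed
      finally show "\<exists>N\<in>perfect_matchings V E. sum w N < sum w P" using excluded[OF P(1)] by blast
    qed
  next
    assume "\<exists>U\<in>odd_sets V. 0 < z U \<and> card (edges_in M U) < card U div 2"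
    then obtain U where U: "U \<in> odd_sets V" "0 < z U" "card (edges_in M U) < card U div 2" by blast
    have UV: "U \<subseteq> V" using U(1) by (simp add: odd_sets_def)
    obtain F where F: "F \<subseteq> M" "card F \<le> 2"
      "\<And>P. P \<in> perfect_matchings V E \<Longrightarrow> F \<subseteq> P \<Longrightarrow> 2 * card (edges_in P U) + 2 \<le> card U"
      using two_crossing_edges[OF sg M UV U(3)] by blast
    show ?thesis
    proof (rule that[OF F(1,2)])
      fix P assume P: "P \<in> perfect_matchings V E" "F \<subseteq> P"
      have "sum c P \<le> sum (dual_load V y z) P" using d(4) pm(2)[OF P(1)] by (intro sum_mono) blast
      also have "\<dots> < dual_value V y z"
        unfolding sum_dual_load_perfect_matching[OF sg P(1)] dual_value_def
      proof (intro add_strict_left_mono sum_strict_mono_ex1)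
        show "finite (odd_sets V)" using finite_odd_sets[OF finV] .
        show "\<forall>U\<in>odd_sets V. z U * int (card (edges_in P U)) \<le> z U * int (card U div 2)"
        proof
          fix U assume "U \<in> odd_sets V"
          then have "finite U" using finV finite_subset by (auto simp: odd_sets_def)
          then show "z U * int (card (edges_in P U)) \<le> z U * int (card U div 2)"
            using matching_edges_in_odd_set[OF sg pm(1)[OF P(1)], of U "{}"] d(3)[of U]
            by (intro mult_left_mono) auto
        qed
        have "card (edges_in P U) < card U div 2" using F(3)[OF P] by simp
        then show "\<exists>U\<in>odd_sets V. z U * int (card (edges_in P U)) < z U * int (card U div 2)"
          using U(1,2) by (intro bexI[of _ U] mult_strict_left_mono) auto
      qed
      finally show "\<exists>N\<in>perfect_matchings V E. sum w N < sum w P" using excluded[OF P(1)] by blast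
    qed
  qed
qed

section \<open>Iterated forcing of edges\<close>

text \<open>The form that can be iterated: \<open>F0\<close> holds the edges already forced, and the
  cheaper competitor must contain them too.\<close>

lemma nonminimal_excluded_by_two_edges_relative:
  fixes w :: "'v set \<Rightarrow> int"
  assumes sg: "simple_graph V E" and M: "M \<in> perfect_matchings V E" "F0 \<subseteq> M"
    and notmin: "\<exists>N\<in>perfect_matchings V E. F0 \<subseteq> N \<and> sum w N < sum w M"
  obtains F where "F \<subseteq> M" "card F \<le> 2"
    "\<And>M'. M' \<in> perfect_matchings V E \<Longrightarrow> F0 \<union> F \<subseteq> M' \<Longrightarrow>
       \<exists>N\<in>perfect_matchings V E. F0 \<subseteq> N \<and> sum w N < sum w M'"
proof -
  define B where "B = (\<Sum>e\<in>E. \<bar>w e\<bar>)"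
  \<comment> \<open>A large discount on \<open>F0\<close> forces minimum-weight perfect matchings to contain \<open>F0\<close>.\<close>
  define w' where "w' = (\<lambda>e. w e - (2 * B + 1) * of_bool (e \<in> F0))"
  have finE: "finite E" using sg simple_graph_finite_edges by blast
  have sub: "N \<subseteq> E" if "N \<in> perfect_matchings V E" for N
    using that by (simp add: perfect_matchings_def)
  have finF0: "finite F0" using M sub finE finite_subset by metis
  have B0: "0 \<le> B" by (simp add: B_def sum_nonneg)
  have w'_sum: "sum w' N = sum w N - (2 * B + 1) * int (card (F0 \<inter> N))"
    if "N \<in> perfect_matchings V E" for N
  proof -
    have "finite N" using sub[OF that] finE finite_subset by blast
    then have "(\<Sum>e\<in>N. (of_bool (e \<in> F0) :: int)) = int (card (F0 \<inter> N))"
      by (simp add: of_bool_def sum.If_cases Int_commute)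
    then show ?thesis by (simp add: w'_def sum_subtractf flip: sum_distrib_left)
  qed
  have w'_super: "sum w' N = sum w N - (2 * B + 1) * int (card F0)"
    if "N \<in> perfect_matchings V E" "F0 \<subseteq> N" for N
    using w'_sum[OF that(1)] that(2) by (simp add: Int_absorb2)
  obtain N0 where N0: "N0 \<in> perfect_matchings V E" "F0 \<subseteq> N0" "sum w N0 < sum w M"
    using notmin by blast
  then have "sum w' N0 < sum w' M" using w'_super[OF N0(1,2)] w'_super[OF M] by simp
  then have "\<exists>N\<in>perfect_matchings V E. sum w' N < sum w' M" using N0(1) by blast
  then obtain F where F: "F \<subseteq> M" "card F \<le> 2"
    "\<And>M'. M' \<in> perfect_matchings V E \<Longrightarrow> F \<subseteq> M' \<Longrightarrow>
       \<exists>N\<in>perfect_matchings V E. sum w' N < sum w' M'"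
    by (rule nonminimal_excluded_by_two_edges[OF sg M(1)]) (rule that; simp)
  show ?thesis
  proof (rule that[OF F(1,2)])
    fix M' assume M': "M' \<in> perfect_matchings V E" "F0 \<union> F \<subseteq> M'"
    then obtain N where N: "N \<in> perfect_matchings V E" "sum w' N < sum w' M'" using F(3) by blast
    have s: "sum w' M' = sum w M' - (2 * B + 1) * int (card F0)" using w'_super M' by simp
    \<comment> \<open>\<open>M'\<close> enjoys the full discount. Lacking one edge of
      \<open>F0\<close> would cost \<open>N\<close> at least \<open>2 * B + 1\<close>, more than any
      difference of \<open>w\<close>-weights can compensate.\<close>
    have "F0 \<subseteq> N"
    proof (rule ccontr)
      assume "\<not> F0 \<subseteq> N"
      then have "F0 \<inter> N \<subset> F0" by blast
      then have "card (F0 \<inter> N) < card F0" using finF0 psubset_card_mono by blast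
      then have "int (card (F0 \<inter> N)) + 1 \<le> int (card F0)" by simp
      then have "(2 * B + 1) * (int (card (F0 \<inter> N)) + 1) \<le> (2 * B + 1) * int (card F0)"
        using B0 by (intro mult_left_mono) auto
      then have "(2 * B + 1) * int (card (F0 \<inter> N)) + (2 * B + 1) \<le> (2 * B + 1) * int (card F0)"
        by (simp only: distrib_left mult_1_right)
      then have "2 * B + 1 < sum w M' - sum w N" using s w'_sum[OF N(1)] N(2) by linarith
      moreover have "\<bar>sum w M'\<bar> \<le> B" "\<bar>sum w N\<bar> \<le> B"
        using abs_sum_le_total[OF finE] sub M'(1) N(1) by (auto simp: B_def)
      ultimately show False by linarith
    qed
    then show "\<exists>N\<in>perfect_matchings V E. F0 \<subseteq> N \<and> sum w N < sum w M'"
      using N s w'_super[OF N(1)] by (intro bexI[of _ N]) auto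
  qed
qed

lemma finite_perfect_matchings: "simple_graph V E \<Longrightarrow> finite (perfect_matchings V E)"
  by (rule finite_subset[of _ "Pow E"])
    (auto simp: perfect_matchings_def simple_graph_finite_edges)

text \<open>Each round spends at most two edges and eliminates at least the smallest of the
  remaining weights below that of \<open>M\<close>.\<close>

lemma edges_forcing_min_weight:
  fixes w :: "'v set \<Rightarrow> int"
  assumes sg: "simple_graph V E" and "M \<in> perfect_matchings V E" "F0 \<subseteq> M"
  shows "\<exists>F. F0 \<subseteq> F \<and> F \<subseteq> M \<and>
    card F \<le> card F0 + 2 * card {sum w N |N. N \<in> perfect_matchings V E \<and> F0 \<subseteq> N \<and> sum w N < sum w M} \<and>
    (\<forall>N\<in>perfect_matchings V E. F \<subseteq> N \<longrightarrow> sum w M \<le> sum w N)"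
  using assms(3)
proof (induction "card {sum w N |N. N \<in> perfect_matchings V E \<and> F0 \<subseteq> N \<and> sum w N < sum w M}"
    arbitrary: F0 rule: less_induct)
  case less
  define S where
    "S = (\<lambda>F. {sum w N |N. N \<in> perfect_matchings V E \<and> F \<subseteq> N \<and> sum w N < sum w M})"
  have "S F \<subseteq> sum w ` perfect_matchings V E" for F by (auto simp: S_def)
  then have finS: "finite (S F)" for F
    using finite_perfect_matchings[OF sg] finite_subset by blast
  show ?case
  proof (cases "S F0 = {}")
    case True
    have "sum w M \<le> sum w N" if "N \<in> perfect_matchings V E" "F0 \<subseteq> N" for N
    proof (rule ccontr)
      assume "\<not> sum w M \<le> sum w N"
      then have "sum w N \<in> S F0" using that unfolding S_def by auto
      then show False using True by simp
    qed
    then show ?thesis using less.prems by (intro exI[of _ F0]) simp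
  next
    case False
    then have "\<exists>N\<in>perfect_matchings V E. F0 \<subseteq> N \<and> sum w N < sum w M" by (auto simp: S_def)
    then obtain F where F: "F \<subseteq> M" "card F \<le> 2"
      "\<And>M'. M' \<in> perfect_matchings V E \<Longrightarrow> F0 \<union> F \<subseteq> M' \<Longrightarrow>
         \<exists>N\<in>perfect_matchings V E. F0 \<subseteq> N \<and> sum w N < sum w M'"
      by (rule nonminimal_excluded_by_two_edges_relative[OF sg assms(2) less.prems]) (rule that; simp)
    have "Min (S F0) \<in> S F0" using finS False by simp
    \<comment> \<open>A matching that contains \<open>F0 \<union> F\<close> has a cheaper competitor
      containing \<open>F0\<close>, whose weight lies in \<open>S F0\<close>; so it cannot attain
      the minimum.\<close>
    moreover have "Min (S F0) \<notin> S (F0 \<union> F)"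
    proof
      assume "Min (S F0) \<in> S (F0 \<union> F)"
      then obtain M' where M': "M' \<in> perfect_matchings V E" "F0 \<union> F \<subseteq> M'"
        "sum w M' < sum w M" "sum w M' = Min (S F0)" by (auto simp: S_def)
      then obtain N where N: "N \<in> perfect_matchings V E" "F0 \<subseteq> N" "sum w N < sum w M'"
        using F(3) by blast
      then have "sum w N \<in> S F0" using M'(3) by (auto simp: S_def)
      then have "Min (S F0) \<le> sum w N" using finS by simp
      then show False using N M' by simp
    qed
    moreover have "S (F0 \<union> F) \<subseteq> S F0" by (auto simp: S_def)
    ultimately have lt: "card (S (F0 \<union> F)) < card (S F0)"
      using finS by (intro psubset_card_mono) auto
    then obtain F' where F': "F0 \<union> F \<subseteq> F'" "F' \<subseteq> M"
      "card F' \<le> card (F0 \<union> F) + 2 * card (S (F0 \<union> F))"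
      "\<forall>N\<in>perfect_matchings V E. F' \<subseteq> N \<longrightarrow> sum w M \<le> sum w N"
      using less.hyps[of "F0 \<union> F"] less.prems F(1) unfolding S_def by blast
    have "card F' \<le> card F0 + 2 * card (S F0)"
      using F'(3) lt F(2) card_Un_le[of F0 F] by linarith
    then show ?thesis using F' unfolding S_def by blast
  qed
qed

section \<open>Weight classes of perfect matchings\<close>

lemma smallest_perfect_matchings_eq:
  assumes "l \<ge> 1"
  shows "smallest_perfect_matchings V E w l = min_weight_members w
    (perfect_matchings V E - (\<Union>l'\<in>{1..<l}. smallest_perfect_matchings V E w l'))"
proof -
  consider "l = Suc 0" | k where "l = Suc (Suc k)" using assms by (metis One_nat_def Suc_le_D old.nat.exhaust)
  then show ?thesis by cases (simp_all del: atLeastLessThan_iff)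
qed

text \<open>A perfect matching lighter than \<open>M\<close> must have been removed in an earlier
  class, and all members of one class share a single weight.\<close>

lemma card_smaller_weights:
  assumes "l \<ge> 1" "M \<in> smallest_perfect_matchings V E w l"
  shows "card {sum w N |N. N \<in> perfect_matchings V E \<and> sum w N < sum w M} \<le> l - 1"
proof -
  have same: "weight w N = weight w N'"
    if "i \<ge> 1" "N \<in> smallest_perfect_matchings V E w i" "N' \<in> smallest_perfect_matchings V E w i"
    for i N N'
    using that unfolding smallest_perfect_matchings_eq[OF that(1)] min_weight_members_def
    by (intro antisym) blast+
  \<comment> \<open>For an empty class the choice returns an arbitrary value; this is harmless, as
    the image only serves as an upper bound.\<close>
  define rep where "rep = (\<lambda>i. weight w (SOME N. N \<in> smallest_perfect_matchings V E w i))"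
  have "{sum w N |N. N \<in> perfect_matchings V E \<and> sum w N < sum w M} \<subseteq> rep ` {1..<l}"
  proof clarify
    fix N assume N: "N \<in> perfect_matchings V E" "sum w N < sum w M"
    have "N \<notin> perfect_matchings V E - (\<Union>i\<in>{1..<l}. smallest_perfect_matchings V E w i)"
    proof
      assume "N \<in> perfect_matchings V E - (\<Union>i\<in>{1..<l}. smallest_perfect_matchings V E w i)"
      then have "weight w M \<le> weight w N"
        using assms(2) unfolding smallest_perfect_matchings_eq[OF assms(1)] min_weight_members_def
        by blast
      then show False using N(2) by (simp add: weight_def)
    qed
    then obtain i where i: "i \<in> {1..<l}" "N \<in> smallest_perfect_matchings V E w i"
      using N(1) by blast
    then have "weight w N = rep i"
      unfolding rep_def by (intro same[of i]) (auto intro: someI)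
    then show "sum w N \<in> rep ` {1..<l}" using i(1) by (auto simp: weight_def)
  qed
  then have "card {sum w N |N. N \<in> perfect_matchings V E \<and> sum w N < sum w M} \<le> card (rep ` {1..<l})"
    by (intro card_mono) auto
  also have "\<dots> \<le> l - 1" using card_image_le[of "{1..<l}" rep] by simp
  finally show ?thesis .
qed

theorem mainTheorem1:
  fixes V :: "'v set" and E :: "'v set set" and w :: "'v set \<Rightarrow> int"
    and l :: nat and M :: "'v set set"
  assumes "simple_graph V E"
    and "l \<ge> 1"
    and "M \<in> smallest_perfect_matchings V E w l"
  shows "\<exists>F. F \<subseteq> E \<and> card F \<le> 2 * (l - 1) \<and>
           {M' \<in> perfect_matchings V E. F \<subseteq> M'} \<noteq> {} \<and>
           weight w M = Min (weight w ` {M' \<in> perfect_matchings V E. F \<subseteq> M'})"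
proof -
  have M: "M \<in> perfect_matchings V E"
    using assms(3) unfolding smallest_perfect_matchings_eq[OF assms(2)] min_weight_members_def by blast
  obtain F where F: "F \<subseteq> M"
    "card F \<le> 2 * card {sum w N |N. N \<in> perfect_matchings V E \<and> sum w N < sum w M}"
    "\<And>N. N \<in> perfect_matchings V E \<Longrightarrow> F \<subseteq> N \<Longrightarrow> sum w M \<le> sum w N"
    using edges_forcing_min_weight[OF assms(1) M, of "{}" w] by auto
  have "F \<subseteq> E" using F(1) M by (auto simp: perfect_matchings_def)
  moreover have "card F \<le> 2 * (l - 1)" using F(2) card_smaller_weights[OF assms(2,3)] by linarith
  \<comment> \<open>Since \<open>F \<subseteq> M\<close>, the matching \<open>M\<close> is itself a
    competitor and attains the minimum.\<close>
  moreover have "weight w M = Min (weight w ` {M' \<in> perfect_matchings V E. F \<subseteq> M'})"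
    using F M finite_perfect_matchings[OF assms(1)]
    by (intro Min_eqI[symmetric]) (auto simp: weight_def)
  ultimately show ?thesis using F(1) M by blast
qed

end
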